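(* Let $p\geq 2$ and let $G$ be a finite simple $\{pK_2, K_1+C_4\}$-free graph. Then $\chi(G)\leq f_p(\omega(G))$, where $f_p:\mathbb{N}\to\mathbb{N}$ ($p\geq2$) is defined by: $f_t(1)=1$ for $t\geq 2$; $f_2(s)=s+1$ for $s\geq 2$; $f_p(2)=2p-2$ for $p\geq 3$; and $f_p(m)=\left(\sum_{j=2}^{m} f_{p-1}(j)\right)+f_{p-1}(m-1)+1$ for $m,p\geq 3$.
   Context: $\chi(G)$ is the chromatic number and $\omega(G)$ the clique number of $G$. $pK_2$ is the disjoint union of $p$ edges. $K_1+C_4$ is the wheel on five vertices: a $4$-cycle plus a vertex adjacent to all four of its vertices. A graph is $\mathcal{F}$-free if it has no induced subgraph isomorphic to a member of $\mathcal{F}$. *)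

theory Defs
  imports "Graph_Theory.Graph_Theory"
begin

text \<open>
  A finite simple graph is a \<^locale>\<open>pair_graph\<close>: finitely many vertices, and a symmetric,
  irreflexive set of arcs, the arcs \<open>(u, v)\<close> and \<open>(v, u)\<close> together standing for the edge \<open>uv\<close>.
  The graph without vertices is allowed.
\<close>

definition is_clique :: "'a pair_pre_digraph \<Rightarrow> 'a set \<Rightarrow> bool" where
  "is_clique G C \<longleftrightarrow> C \<subseteq> pverts G \<and> (\<forall>u\<in>C. \<forall>v\<in>C. u \<noteq> v \<longrightarrow> (u, v) \<in> parcs G)"

definition clique_number :: "'a pair_pre_digraph \<Rightarrow> nat" where
  "clique_number G = Max (card ` {C. is_clique G C})"

definition proper_coloring :: "'a pair_pre_digraph \<Rightarrow> nat \<Rightarrow> ('a \<Rightarrow> nat) \<Rightarrow> bool" where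
  "proper_coloring G k c \<longleftrightarrow>
     (\<forall>v\<in>pverts G. c v < k) \<and> (\<forall>(u, v)\<in>parcs G. c u \<noteq> c v)"

definition chromatic_number :: "'a pair_pre_digraph \<Rightarrow> nat" where
  "chromatic_number G = (LEAST k. \<exists>c. proper_coloring G k c)"

definition induced_free :: "'b pair_pre_digraph set \<Rightarrow> 'a pair_pre_digraph \<Rightarrow> bool" where
  "induced_free \<F> G \<longleftrightarrow>
     \<not> (\<exists>F\<in>\<F>. \<exists>H. induced_subgraph H (with_proj G) \<and> digraph_iso (with_proj F) H)"

definition pK2 :: "nat \<Rightarrow> nat pair_pre_digraph" where
  "pK2 p = \<lparr> pverts = {..<2 * p},
             parcs = (\<Union>i<p. {(2 * i, 2 * i + 1), (2 * i + 1, 2 * i)}) \<rparr>"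

text \<open>The 4-cycle is \<open>0, 1, 2, 3\<close>; the vertex adjacent to all of it is \<open>4\<close>.\<close>

definition K1_join_C4 :: "nat pair_pre_digraph" where
  "K1_join_C4 =
     (let E = {(0, 1), (1, 2), (2, 3), (3, 0)} \<union> {(4, 0), (4, 1), (4, 2), (4, 3)}
      in \<lparr> pverts = {0, 1, 2, 3, 4}, parcs = E \<union> E\<inverse> \<rparr>)"

text \<open>
  \<open>f_bound p m\<close> is $f_p(m)$, for \<open>p \<ge> 2\<close> and \<open>m \<ge> 1\<close>. The values at \<open>p < 2\<close> and at \<open>m = 0\<close> are
  arbitrary and never enter the recursion for \<open>p \<ge> 2\<close>, \<open>m \<ge> 1\<close>.
\<close>

fun f_bound :: "nat \<Rightarrow> nat \<Rightarrow> nat" where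
  "f_bound p m =
     (if m = 0 then 0
      else if m = 1 then 1
      else if p \<le> 2 then m + 1
      else if m = 2 then 2 * p - 2
      else (\<Sum>j=2..m. f_bound (p - 1) j) + f_bound (p - 1) (m - 1) + 1)"

declare f_bound.simps [simp del]

lemma f_bound_one: "f_bound t 1 = 1"
  by (simp add: f_bound.simps)

lemma f_bound_base: "s \<ge> 2 \<Longrightarrow> f_bound 2 s = s + 1"
  by (simp add: f_bound.simps)

lemma f_bound_two: "p \<ge> 3 \<Longrightarrow> f_bound p 2 = 2 * p - 2"
  by (simp add: f_bound.simps)

lemma f_bound_rec:
  "m \<ge> 3 \<Longrightarrow> p \<ge> 3 \<Longrightarrow>
     f_bound p m = (\<Sum>j=2..m. f_bound (p - 1) j) + f_bound (p - 1) (m - 1) + 1"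
  by (subst f_bound.simps) simp

lemma pair_graph_pK2: "pair_graph (pK2 p)"
  by unfold_locales (auto simp: pK2_def symmetric_def sym_def)

lemma pair_graph_K1_join_C4: "pair_graph K1_join_C4"
  by unfold_locales (auto simp: K1_join_C4_def symmetric_def sym_def Let_def)

lemma proper_coloring_chromatic_number:
  assumes "pair_graph G"
  shows "\<exists>c. proper_coloring G (chromatic_number G) c"
proof -
  interpret pair_graph G by fact
  obtain c :: "'a \<Rightarrow> nat" where c: "bij_betw c (pverts G) {0..<card (pverts G)}"
    using ex_bij_betw_finite_nat[OF pair_finite_verts] by blast
  have "proper_coloring G (card (pverts G)) c"
    unfolding proper_coloring_def
  proof (intro conjI ballI, goal_cases)
    case (1 v) then show ?case using c by (auto simp: bij_betw_def)
  next
    case (2 e)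
    then have "fst e \<in> pverts G" "snd e \<in> pverts G" "fst e \<noteq> snd e"
      using arc_fst_in_verts arc_snd_in_verts pair_no_loops by blast+
    then show ?case using c by (auto simp: bij_betw_def inj_on_eq_iff split: prod.splits)
  qed
  then have "\<exists>c. proper_coloring G (card (pverts G)) c" by blast
  then show ?thesis unfolding chromatic_number_def by (rule LeastI)
qed

lemma induced_copy_iff_embedding:
  assumes F: "pair_wf_digraph F" and G: "pair_wf_digraph G"
  shows "(\<exists>H. induced_subgraph H (with_proj G) \<and> digraph_iso (with_proj F) H) \<longleftrightarrow>
         (\<exists>h. inj_on h (pverts F) \<and> h ` pverts F \<subseteq> pverts G \<and>
              (\<forall>u\<in>pverts F. \<forall>v\<in>pverts F. (h u, h v) \<in> parcs G \<longleftrightarrow> (u, v) \<in> parcs F))"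
    (is "?L \<longleftrightarrow> ?R")
proof
  interpret F: pair_wf_digraph F by (rule F)
  interpret G: pair_wf_digraph G by (rule G)
  assume ?L
  then obtain H k where H: "induced_subgraph H (with_proj G)"
    and k: "pre_digraph.digraph_isomorphism (with_proj F) k" "H = app_iso k (with_proj F)"
    unfolding digraph_iso_def by blast
  define h where "h = iso_verts k"
  have vH: "verts H = h ` pverts F" and aH: "arcs H = iso_arcs k ` parcs F"
    using k by (auto simp: h_def)
  have tl: "iso_tail k = fst" "iso_head k = snd"
    using H k(2) by (auto simp: induced_subgraph_def subgraph_def compatible_def)
  have inj: "inj_on h (pverts F)"
    using k(1) by (auto simp: F.digraph_isomorphism_def h_def)
  have arc: "iso_arcs k (u, v) = (h u, h v)" if "(u, v) \<in> parcs F" for u v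
    using k(1) that tl by (force simp: F.digraph_isomorphism_def h_def prod_eq_iff)
  have sub: "h ` pverts F \<subseteq> pverts G"
    using H vH by (auto simp: induced_subgraph_def subgraph_def)
  have ind: "arcs H = {e \<in> parcs G. fst e \<in> verts H \<and> snd e \<in> verts H}"
    using H by (auto simp: induced_subgraph_def)
  have "(h u, h v) \<in> parcs G \<longleftrightarrow> (u, v) \<in> parcs F" if uv: "u \<in> pverts F" "v \<in> pverts F" for u v
  proof
    assume "(h u, h v) \<in> parcs G"
    then have "(h u, h v) \<in> arcs H" using ind vH uv by auto
    then obtain a b where ab: "(a, b) \<in> parcs F" "(h u, h v) = iso_arcs k (a, b)"
      using aH by auto
    then have "h u = h a" "h v = h b" using arc by auto
    moreover have "a \<in> pverts F" "b \<in> pverts F" using ab F.in_arcsD1 F.in_arcsD2 by auto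
    ultimately show "(u, v) \<in> parcs F" using ab inj uv by (metis inj_onD)
  next
    assume "(u, v) \<in> parcs F"
    then have "(h u, h v) \<in> arcs H" using aH arc by force
    then show "(h u, h v) \<in> parcs G" using ind by auto
  qed
  then show ?R using inj sub by blast
next
  interpret F: pair_wf_digraph F by (rule F)
  interpret G: pair_wf_digraph G by (rule G)
  assume ?R
  then obtain h where inj: "inj_on h (pverts F)" and sub: "h ` pverts F \<subseteq> pverts G"
    and e: "\<forall>u\<in>pverts F. \<forall>v\<in>pverts F. (h u, h v) \<in> parcs G \<longleftrightarrow> (u, v) \<in> parcs F" by blast
  define k where "k = \<lparr> iso_verts = h, iso_arcs = map_prod h h, iso_head = snd, iso_tail = fst \<rparr>"
  have inj2: "inj_on (map_prod h h) (parcs F)"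
    using map_prod_inj_on[OF inj inj] by (rule inj_on_subset) (auto dest: F.in_arcsD1 F.in_arcsD2)
  have iso: "pre_digraph.digraph_isomorphism (with_proj F) k"
    using inj inj2 F.wf_digraph by (auto simp: F.digraph_isomorphism_def k_def)
  have eq: "map_prod h h ` parcs F = {e \<in> parcs G. fst e \<in> h ` pverts F \<and> snd e \<in> h ` pverts F}"
  proof (intro set_eqI iffI)
    fix x assume "x \<in> map_prod h h ` parcs F"
    then show "x \<in> {e \<in> parcs G. fst e \<in> h ` pverts F \<and> snd e \<in> h ` pverts F}"
      using e by (auto dest: F.in_arcsD1 F.in_arcsD2)
  next
    fix x assume "x \<in> {e \<in> parcs G. fst e \<in> h ` pverts F \<and> snd e \<in> h ` pverts F}"
    then obtain u v where "x = (h u, h v)" "u \<in> pverts F" "v \<in> pverts F" "x \<in> parcs G"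
      by (cases x) auto
    then show "x \<in> map_prod h h ` parcs F" using e by force
  qed
  have "induced_subgraph (app_iso k (with_proj F)) (with_proj G)"
    unfolding induced_subgraph_def subgraph_def compatible_def
    using F.wf_digraphI_app_iso[OF iso] G.wf_digraph sub eq
    by (auto simp: k_def)
  then show ?L using iso unfolding digraph_iso_def by blast
qed

end

theory Submission
  imports Defs
begin

text \<open>
  Fix a maximum clique \<open>v 1, \<dots>, v m\<close> with \<open>m \<ge> 3\<close> and sort the other vertices by their first two
  non-neighbours \<open>v i\<close>, \<open>v j\<close> in it (\<open>i < j\<close>). Each class \<open>A i j\<close> misses the edge joining \<open>v i\<close> and
  \<open>v j\<close>, so it contains no induced \<open>(p - 1)K\<^sub>2\<close>, and its clique number is at most \<open>m - j + 2\<close>. Without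
  an induced \<open>K\<^sub>1 + C\<^sub>4\<close>, the classes with the same \<open>j \<ge> 4\<close> are pairwise anticomplete and share
  their colours, and the vertices with exactly one non-neighbour form an independent set. The clique
  vertices can be added to classes which they miss, so they cost no colour, and induction on \<open>p\<close>
  gives the recursion.

  If \<open>m = 2\<close>, deleting the neighbours of both ends of an edge costs two colours and lowers \<open>p\<close> by
  one, which leaves the case \<open>p = 3\<close>: a triangle-free graph without induced \<open>3K\<^sub>2\<close> is 4-colourable.
  Otherwise no three vertices have neighbourhoods meeting all edges, and it follows that for every
  induced \<open>2K\<^sub>2\<close> with edges \<open>pq\<close> and \<open>ab\<close> there is an induced 5-cycle through \<open>ab\<close> that misses
  \<open>p\<close> and \<open>q\<close>. This rules out, one after the other, two 5-cycles sharing a vertex, two anticomplete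
  5-cycles, and a 5-cycle anticomplete to an edge, although the last must exist.
\<close>

section \<open>Colourings of vertex sets\<close>

text \<open>A bare relation with a separate vertex set stands for a graph, so that passing to an
  induced subgraph only changes the set.\<close>

definition colorable :: "('a \<Rightarrow> 'a \<Rightarrow> bool) \<Rightarrow> 'a set \<Rightarrow> nat \<Rightarrow> bool" where
  "colorable E S k \<longleftrightarrow>
     (\<exists>c :: 'a \<Rightarrow> nat. (\<forall>v\<in>S. c v < k) \<and> (\<forall>u\<in>S. \<forall>v\<in>S. E u v \<longrightarrow> c u \<noteq> c v))"

definition clique :: "('a \<Rightarrow> 'a \<Rightarrow> bool) \<Rightarrow> 'a set \<Rightarrow> bool" where
  "clique E C \<longleftrightarrow> (\<forall>u\<in>C. \<forall>v\<in>C. u \<noteq> v \<longrightarrow> E u v)"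

text \<open>The sets may overlap: \<open>anticomplete E S S\<close> says that \<open>S\<close> is
  independent.\<close>

definition anticomplete :: "('a \<Rightarrow> 'a \<Rightarrow> bool) \<Rightarrow> 'a set \<Rightarrow> 'a set \<Rightarrow> bool" where
  "anticomplete E X Y \<longleftrightarrow> (\<forall>x\<in>X. \<forall>y\<in>Y. \<not> E x y)"

text \<open>Unrolls statements about listed vertices into single non-adjacencies, the form that the
  propositional refutations need.\<close>

lemma anticomplete_simps:
  "anticomplete E {} Y \<longleftrightarrow> True" "anticomplete E X {} \<longleftrightarrow> True"
  "anticomplete E (insert x X) (insert y Y) \<longleftrightarrow>
     \<not> E x y \<and> anticomplete E {x} Y \<and> anticomplete E X (insert y Y)"
  by (auto simp: anticomplete_def)

text \<open>Disjointness of the edges is implied: a vertex shared by two of them would be adjacent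
  to an end of the other, against anticompleteness.\<close>

definition induced_matching :: "('a \<Rightarrow> 'a \<Rightarrow> bool) \<Rightarrow> 'a set \<Rightarrow> nat \<Rightarrow> bool" where
  "induced_matching E S p \<longleftrightarrow> (\<exists>a b.
     (\<forall>i<p. a i \<in> S \<and> b i \<in> S \<and> E (a i) (b i)) \<and>
     (\<forall>i<p. \<forall>j<p. i \<noteq> j \<longrightarrow> anticomplete E {a i, b i} {a j, b j}))"

definition wheel_free :: "('a \<Rightarrow> 'a \<Rightarrow> bool) \<Rightarrow> 'a set \<Rightarrow> bool" where
  "wheel_free E S \<longleftrightarrow> \<not> (\<exists>a\<in>S. \<exists>b\<in>S. \<exists>c\<in>S. \<exists>d\<in>S. \<exists>h\<in>S. a \<noteq> c \<and> b \<noteq> d \<and>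
     E a b \<and> E b c \<and> E c d \<and> E d a \<and> \<not> E a c \<and> \<not> E b d \<and> E h a \<and> E h b \<and> E h c \<and> E h d)"

lemma colorable_mono: "colorable E S k \<Longrightarrow> k \<le> l \<Longrightarrow> colorable E S l"
  unfolding colorable_def using order_less_le_trans by blast

lemma colorable_subset: "colorable E S k \<Longrightarrow> T \<subseteq> S \<Longrightarrow> colorable E T k"
  unfolding colorable_def by blast

lemma colorable_empty: "colorable E {} k"
  by (simp add: colorable_def)

lemma colorable_independent: "anticomplete E S S \<Longrightarrow> colorable E S 1"
  unfolding colorable_def anticomplete_def by (intro exI[of _ "\<lambda>_. 0"]) auto

lemma colorable_Un:
  assumes "colorable E A k" "colorable E B l"
  shows "colorable E (A \<union> B) (k + l)"
proof -
  obtain c d :: "'a \<Rightarrow> nat" where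
    c: "\<forall>v\<in>A. c v < k" "\<forall>u\<in>A. \<forall>v\<in>A. E u v \<longrightarrow> c u \<noteq> c v" and
    d: "\<forall>v\<in>B. d v < l" "\<forall>u\<in>B. \<forall>v\<in>B. E u v \<longrightarrow> d u \<noteq> d v"
    using assms unfolding colorable_def by blast
  define e where "e v = (if v \<in> A then c v else k + d v)" for v
  have "e u \<noteq> e v" if "u \<in> A \<union> B" "v \<in> A \<union> B" "E u v" for u v
  proof (cases "u \<in> A \<longleftrightarrow> v \<in> A")
    case True then show ?thesis using c d that by (auto simp: e_def)
  next
    case False
    then show ?thesis using c(1) by (metis e_def not_add_less1)
  qed
  moreover have "\<forall>v\<in>A \<union> B. e v < k + l"
    using c(1) d(1) by (auto simp: e_def trans_less_add1)
  ultimately show ?thesis unfolding colorable_def by blast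
qed

lemma colorable_UN:
  assumes "finite J" "\<And>j. j \<in> J \<Longrightarrow> colorable E (A j) (k j)"
  shows "colorable E (\<Union>j\<in>J. A j) (\<Sum>j\<in>J. k j)"
  using assms by (induction J) (auto intro: colorable_Un colorable_empty)

lemma colorable_UN_anticomplete:
  fixes E :: "'a \<Rightarrow> 'a \<Rightarrow> bool" and A :: "'b \<Rightarrow> 'a set"
  assumes "\<And>j. j \<in> J \<Longrightarrow> colorable E (A j) k"
    and anti: "\<And>i j. i \<in> J \<Longrightarrow> j \<in> J \<Longrightarrow> i \<noteq> j \<Longrightarrow> anticomplete E (A i) (A j)"
  shows "colorable E (\<Union>j\<in>J. A j) k"
proof -
  have "\<forall>j\<in>J. \<exists>c :: 'a \<Rightarrow> nat. (\<forall>v\<in>A j. c v < k) \<and> (\<forall>u\<in>A j. \<forall>v\<in>A j. E u v \<longrightarrow> c u \<noteq> c v)"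
    using assms(1) unfolding colorable_def by blast
  then obtain c :: "'b \<Rightarrow> 'a \<Rightarrow> nat" where
    c: "\<And>j v. j \<in> J \<Longrightarrow> v \<in> A j \<Longrightarrow> c j v < k"
       "\<And>j u v. j \<in> J \<Longrightarrow> u \<in> A j \<Longrightarrow> v \<in> A j \<Longrightarrow> E u v \<Longrightarrow> c j u \<noteq> c j v"
    by (metis (no_types, lifting) bchoice)
  \<comment> \<open>The sets may overlap, so each vertex takes its colour from one chosen set. Both
    ends of an edge then have the same chosen set.\<close>
  define part where "part v = (SOME j. j \<in> J \<and> v \<in> A j)" for v
  have part: "part v \<in> J \<and> v \<in> A (part v)" if "v \<in> (\<Union>j\<in>J. A j)" for v
    unfolding part_def using that someI_ex[of "\<lambda>j. j \<in> J \<and> v \<in> A j"] by blast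
  have "part u = part v" if "u \<in> (\<Union>j\<in>J. A j)" "v \<in> (\<Union>j\<in>J. A j)" "E u v" for u v
    using anti[of "part u" "part v"] part[of u] part[of v] that unfolding anticomplete_def by blast
  then have "c (part u) u \<noteq> c (part v) v"
    if "u \<in> (\<Union>j\<in>J. A j)" "v \<in> (\<Union>j\<in>J. A j)" "E u v" for u v
    using that part[of u] part[of v] c(2)[of "part v" u v] by simp
  then show ?thesis
    unfolding colorable_def using part c(1) by (intro exI[of _ "\<lambda>v. c (part v) v"]) blast
qed

text \<open>Supplies the hub of a forbidden wheel when the clique vertices numbered \<open>i\<close>
  and \<open>k\<close> lie on its rim.\<close>

lemma third_index: "\<exists>l. 1 \<le> l \<and> l \<le> (3::nat) \<and> l \<noteq> i \<and> l \<noteq> k"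
  by presburger

section \<open>Layers of a maximum clique\<close>

locale graph =
  fixes E :: "'a \<Rightarrow> 'a \<Rightarrow> bool"
  assumes sym: "E x y \<Longrightarrow> E y x" and irrefl: "\<not> E x x"
begin

lemma commute: "E x y \<longleftrightarrow> E y x"
  using sym by blast

lemma induced_matching_add_edge:
  assumes "induced_matching E T p" "T \<subseteq> S" "u \<in> S" "v \<in> S" "E u v" "anticomplete E {u, v} T"
  shows "induced_matching E S (Suc p)"
proof -
  obtain a b where ab: "\<forall>i<p. a i \<in> T \<and> b i \<in> T \<and> E (a i) (b i)"
    "\<forall>i<p. \<forall>j<p. i \<noteq> j \<longrightarrow> anticomplete E {a i, b i} {a j, b j}"
    using assms(1) unfolding induced_matching_def by blast
  have "anticomplete E {u, v} {a i, b i}" "anticomplete E {a i, b i} {u, v}" if "i < p" for i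
    using assms(6) ab(1) that sym unfolding anticomplete_def by blast+
  then show ?thesis
    unfolding induced_matching_def using ab assms(2-5)
    by (intro exI[of _ "a(p := u)"] exI[of _ "b(p := v)"]) (auto simp: less_Suc_eq)
qed

lemma independent_if_no_induced_matching:
  assumes "\<not> induced_matching E S 1"
  shows "anticomplete E S S"
proof -
  have "\<not> E u v" if "u \<in> S" "v \<in> S" for u v
    using assms that unfolding induced_matching_def
    by (auto dest: spec[of _ "\<lambda>_. u"] spec[of _ "\<lambda>_. v"])
  then show ?thesis by (auto simp: anticomplete_def)
qed

text \<open>\<open>g\<close> stands for the bound at \<open>p - 1\<close> as a function of the
  clique number. It is a parameter because for \<open>p = 2\<close> a set that misses an edge is
  independent and one colour suffices.\<close>

lemma colorable_layers:
  fixes g :: "nat \<Rightarrow> nat"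
  assumes S: "finite S" "wheel_free E S"
    and m: "m \<ge> 3" "\<And>C. C \<subseteq> S \<Longrightarrow> clique E C \<Longrightarrow> card C \<le> m"
    and K: "K \<subseteq> S" "clique E K" "card K = m"
    and g: "\<And>k. k \<ge> 2 \<Longrightarrow> g k \<ge> 1"
    and col: "\<And>T u v k. T \<subseteq> S \<Longrightarrow> u \<in> S \<Longrightarrow> v \<in> S \<Longrightarrow> E u v \<Longrightarrow> anticomplete E {u, v} T \<Longrightarrow> k \<ge> 2 \<Longrightarrow>
        (\<And>C. C \<subseteq> T \<Longrightarrow> clique E C \<Longrightarrow> card C \<le> k) \<Longrightarrow> colorable E T (g k)"
  shows "colorable E S ((\<Sum>j=2..m. g j) + g (m - 1) + 1)"
proof -
  have "finite K" using K(1) S(1) finite_subset by blast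
  then obtain v where v: "bij_betw v {1..m} K"
    using ex_bij_betw_nat_finite_1 K(3) by metis
  have vS: "v i \<in> S" if "i \<in> {1..m}" for i using v that K(1) by (auto simp: bij_betw_def)
  have v_eq: "v i = v j \<longleftrightarrow> i = j" if "i \<in> {1..m}" "j \<in> {1..m}" for i j
    using v that by (auto simp: bij_betw_def inj_on_eq_iff)
  have vE: "E (v i) (v j)" if "i \<in> {1..m}" "j \<in> {1..m}" "i \<noteq> j" for i j
    using that v_eq K(2) v unfolding clique_def bij_betw_def by blast
  have clique_v: "clique E (v ` I)" "card (v ` I) = card I" if "I \<subseteq> {1..m}" for I
    using that v vE v_eq by (auto simp: clique_def bij_betw_def subset_iff intro!: card_image inj_onI)
  \<comment> \<open>Clique vertices complete to \<open>X\<close> enlarge it; this is the source of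
    every clique bound in the proof.\<close>
  have clique_Un: "card X + card I \<le> m"
    if "X \<subseteq> S" "clique E X" "I \<subseteq> {1..m}" "\<And>x i. x \<in> X \<Longrightarrow> i \<in> I \<Longrightarrow> E x (v i)" for X I
  proof -
    have "clique E (X \<union> v ` I)"
      using that clique_v(1)[OF that(3)] sym unfolding clique_def by blast
    moreover have "X \<inter> v ` I = {}" using that(4) irrefl by blast
    moreover have "finite X" "finite I"
      using that S(1) finite_subset by blast+
    moreover have "X \<union> v ` I \<subseteq> S" using that(1,3) vS by blast
    ultimately show ?thesis
      using m(2)[of "X \<union> v ` I"] clique_v(2)[OF that(3)] by (simp add: card_Un_disjoint)
  qed

  define A where "A i j = {x \<in> S. \<not> E x (v i) \<and> \<not> E x (v j) \<and> (\<forall>k\<in>{1..<j}. k \<noteq> i \<longrightarrow> E x (v k))}" for i j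
  define I where "I = {x \<in> S - K. \<exists>i\<in>{1..m}. \<not> E x (v i) \<and> (\<forall>k\<in>{1..m}. k \<noteq> i \<longrightarrow> E x (v k))}"
  define L where "L j = (\<Union>i\<in>{1..<j}. A i j) \<union> {v j}" for j

  \<comment> \<open>A clique vertex has no non-neighbour in the clique but itself, while a member of
    \<open>A i j\<close> has two.\<close>
  have v_notin_A: "v k \<notin> A i j" if "k \<in> {1..m}" "i \<in> {1..<j}" "j \<le> m" for i j k
    using vE[of k i] vE[of k j] that unfolding A_def by (cases "k = i") auto
  \<comment> \<open>If \<open>x\<close> and \<open>y\<close> were adjacent, \<open>x\<close>,
    \<open>v k\<close>, \<open>v i\<close>, \<open>y\<close> would be the rim of a wheel with hub
    \<open>v l\<close>.\<close>
  have no_wheel: "\<not> E x y"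
    if "x \<in> S" "y \<in> S" "{i, k, l} \<subseteq> {1..m}" "i \<noteq> k" "l \<noteq> i" "l \<noteq> k" "x \<noteq> v i" "y \<noteq> v k"
      "\<not> E x (v i)" "E x (v k)" "\<not> E y (v k)" "E y (v i)" "E x (v l)" "E y (v l)" for x y i k l
  proof
    assume "E x y"
    moreover have "E (v k) (v i)" "E (v l) (v i)" "E (v l) (v k)" using that(3-6) vE by auto
    ultimately have "x \<noteq> v i \<and> v k \<noteq> y \<and> E x (v k) \<and> E (v k) (v i) \<and> E (v i) y \<and> E y x \<and>
        \<not> E x (v i) \<and> \<not> E (v k) y \<and> E (v l) x \<and> E (v l) (v k) \<and> E (v l) (v i) \<and> E (v l) y"
      using that sym by blast
    moreover have "v i \<in> S" "v k \<in> S" "v l \<in> S" using that(3) vS by auto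
    ultimately show False
      using S(2) that(1,2) unfolding wheel_free_def by blast
  qed

  have A_colorable: "colorable E (A i j) (g (m - j + 2))" if ij: "i \<in> {1..<j}" "j \<le> m" for i j
  proof (rule col)
    show "A i j \<subseteq> S" by (auto simp: A_def)
    show "v i \<in> S" "v j \<in> S" "E (v i) (v j)" using ij vS vE by auto
    show "anticomplete E {v i, v j} (A i j)"
      using commute by (auto simp: anticomplete_def A_def)
    fix C assume C: "C \<subseteq> A i j" "clique E C"
    \<comment> \<open>The \<open>j - 2\<close> vertices \<open>v k\<close> with \<open>k < j\<close>
      and \<open>k \<noteq> i\<close> are complete to \<open>A i j\<close>.\<close>
    have "card C + card ({1..<j} - {i}) \<le> m"
      by (rule clique_Un) (use C ij in \<open>auto simp: A_def\<close>)
    then show "card C \<le> m - j + 2" using ij by simp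
  qed simp
  have A_v: "colorable E (A i j \<union> {v k}) (g (m - j + 2))"
    if ij: "i \<in> {1..<j}" "j \<le> m" and k: "k = i \<or> k = j" for i j k
  proof -
    \<comment> \<open>The union is indexed by \<open>bool\<close> to fit the lemma on anticomplete
      parts; the single vertex fits because \<open>g\<close> is at least 1.\<close>
    have "colorable E (\<Union>b\<in>{True, False}. if b then A i j else {v k}) (g (m - j + 2))"
    proof (rule colorable_UN_anticomplete)
      fix b
      show "colorable E (if b then A i j else {v k}) (g (m - j + 2))"
        using A_colorable[OF ij] g[of "m - j + 2"] irrefl
          colorable_mono[OF colorable_independent, of E "{v k}"] by (auto simp: anticomplete_def)
    next
      fix b c :: bool assume "b \<noteq> c"
      then show "anticomplete E (if b then A i j else {v k}) (if c then A i j else {v k})"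
        using k commute by (auto simp: anticomplete_def A_def)
    qed
    then show ?thesis by (simp add: Un_commute)
  qed
  have L_colorable: "colorable E (L j) (g (m - j + 2))" if j: "4 \<le> j" "j \<le> m" for j
  proof -
    \<comment> \<open>The parts overlap in \<open>v j\<close>, which is harmless because
      \<open>v j\<close> misses all of them. For \<open>j \<ge> 4\<close> any two indices below
      \<open>j\<close> leave a third one for the hub.\<close>
    have "colorable E (\<Union>i\<in>{1..<j}. A i j \<union> {v j}) (g (m - j + 2))"
    proof (rule colorable_UN_anticomplete)
      fix i k assume ik: "i \<in> {1..<j}" "k \<in> {1..<j}" "i \<noteq> k"
      obtain l where l: "l \<in> {1..<j}" "l \<noteq> i" "l \<noteq> k" using third_index[of i k] j by force
      have "\<not> E x y" if xy: "x \<in> A i j" "y \<in> A k j" for x y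
      proof (rule no_wheel[of x y i k l])
        show "x \<noteq> v i" "y \<noteq> v k"
          using xy ik j v_notin_A[of i i j] v_notin_A[of k k j] by auto
      qed (use xy ik l j in \<open>auto simp: A_def\<close>)
      moreover have "\<not> E x (v j)" "\<not> E (v j) x" if "x \<in> A i j \<union> A k j" for x
        using that sym[of "v j" x] by (auto simp: A_def)
      ultimately show "anticomplete E (A i j \<union> {v j}) (A k j \<union> {v j})"
        using irrefl by (auto simp: anticomplete_def)
    qed (use A_v j in auto)
    moreover have "L j = (\<Union>i\<in>{1..<j}. A i j \<union> {v j})" using j by (auto simp: L_def)
    ultimately show ?thesis by simp
  qed
  have I_colorable: "colorable E I 1"
  proof (rule colorable_independent)
    have "\<not> E x y" if xy: "x \<in> I" "y \<in> I" for x y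
    proof
      assume "E x y"
      obtain i k where ik: "i \<in> {1..m}" "k \<in> {1..m}" "\<not> E x (v i)" "\<not> E y (v k)"
        "\<forall>l\<in>{1..m}. l \<noteq> i \<longrightarrow> E x (v l)" "\<forall>l\<in>{1..m}. l \<noteq> k \<longrightarrow> E y (v l)"
        using xy unfolding I_def by blast
      \<comment> \<open>With a common non-neighbour, \<open>x\<close>, \<open>y\<close> and the
        other \<open>m - 1\<close> clique vertices form a clique of size \<open>m + 1\<close>; with
        different ones there is a wheel.\<close>
      show False
      proof (cases "i = k")
        case True
        have "card {x, y} + card ({1..m} - {i}) \<le> m"
          by (rule clique_Un) (use xy ik True \<open>E x y\<close> commute in \<open>auto simp: I_def clique_def\<close>)
        moreover have "x \<noteq> y" using \<open>E x y\<close> irrefl by blast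
        ultimately show False using ik(1) by simp
      next
        case False
        obtain l where l: "l \<in> {1..m}" "l \<noteq> i" "l \<noteq> k" using third_index[of i k] m(1) by force
        have "v i \<in> K" "v k \<in> K" using v ik by (auto simp: bij_betw_def)
        then have "\<not> E x y"
          by (intro no_wheel[of x y i k l]) (use xy ik l False in \<open>auto simp: I_def\<close>)
        then show False using \<open>E x y\<close> by blast
      qed
    qed
    then show "anticomplete E I I" by (simp add: anticomplete_def)
  qed

  \<comment> \<open>For \<open>j \<le> 3\<close> there is no third index below \<open>j\<close>, so
    \<open>A 1 2\<close>, \<open>A 1 3\<close> and \<open>A 2 3\<close> get palettes of their own.
    Each of them absorbs one of the first three clique vertices, chosen among those that it
    misses.\<close>
  have cover: "S \<subseteq> I \<union> (A 1 2 \<union> {v 2}) \<union> (A 1 3 \<union> {v 1}) \<union> (A 2 3 \<union> {v 3}) \<union> (\<Union>j\<in>{4..m}. L j)"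
  proof
    fix x assume x: "x \<in> S"
    show "x \<in> I \<union> (A 1 2 \<union> {v 2}) \<union> (A 1 3 \<union> {v 1}) \<union> (A 2 3 \<union> {v 3}) \<union> (\<Union>j\<in>{4..m}. L j)"
    proof (cases "x \<in> K")
      case True
      then obtain i where i: "i \<in> {1..m}" "x = v i" using v by (auto simp: bij_betw_def)
      then have "i = 1 \<or> i = 2 \<or> i = 3 \<or> i \<in> {4..m}" by auto
      then show ?thesis using i(2) by (auto simp: L_def)
    next
      case False
      define i where "i = (LEAST i. i \<in> {1..m} \<and> \<not> E x (v i))"
      have "\<exists>i\<in>{1..m}. \<not> E x (v i)"
        using clique_Un[of "{x}" "{1..m}"] x by (force simp: clique_def)
      then have i: "i \<in> {1..m}" "\<not> E x (v i)"
        unfolding i_def using LeastI_ex[of "\<lambda>i. i \<in> {1..m} \<and> \<not> E x (v i)"] by blast+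
      show ?thesis
      proof (cases "\<forall>k\<in>{1..m}. k \<noteq> i \<longrightarrow> E x (v k)")
        case True then show ?thesis using i x False by (auto simp: I_def)
      next
        case not_all: False
        define j where "j = (LEAST j. j \<in> {1..m} \<and> j \<noteq> i \<and> \<not> E x (v j))"
        have j: "j \<in> {1..m} \<and> j \<noteq> i \<and> \<not> E x (v j)"
          unfolding j_def by (rule LeastI_ex) (use not_all in blast)
        have "i \<le> j" unfolding i_def by (rule Least_le) (use j in blast)
        moreover have "E x (v k)" if "k \<in> {1..<j}" "k \<noteq> i" for k
          using not_less_Least[of k "\<lambda>j. j \<in> {1..m} \<and> j \<noteq> i \<and> \<not> E x (v j)"] that j
          unfolding j_def[symmetric] by auto
        ultimately have ij: "x \<in> A i j" "i \<in> {1..<j}" "j \<in> {1..m}"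
          using i j x by (auto simp: A_def)
        then consider "i = 1" "j = 2" | "i = 1" "j = 3" | "i = 2" "j = 3" | "j \<in> {4..m}"
          by force
        then show ?thesis using ij by cases (auto simp: L_def)
      qed
    qed
  qed
  have "colorable E (I \<union> (A 1 2 \<union> {v 2}) \<union> (A 1 3 \<union> {v 1}) \<union> (A 2 3 \<union> {v 3}) \<union> (\<Union>j\<in>{4..m}. L j))
      (1 + g (m - 2 + 2) + g (m - 3 + 2) + g (m - 3 + 2) + (\<Sum>j\<in>{4..m}. g (m - j + 2)))"
    by (intro colorable_Un colorable_UN I_colorable A_v L_colorable) (use m(1) in auto)
  \<comment> \<open>The layers from 4 on contribute \<open>g 2\<close> up to
    \<open>g (m - 2)\<close>. \<open>A 1 2\<close> adds \<open>g m\<close> and one of the other two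
    classes \<open>g (m - 1)\<close>, which completes the sum; the second \<open>g (m - 1)\<close>
    and the colour of \<open>I\<close> remain.\<close>
  moreover have "(\<Sum>j\<in>{4..m}. g (m - j + 2)) = (\<Sum>j=2..m-2. g j)"
    by (rule sum.reindex_bij_witness[of _ "\<lambda>j. m + 2 - j" "\<lambda>j. m - j + 2"]) auto
  moreover have "(\<Sum>j=2..m. g j) = (\<Sum>j=2..m-2. g j) + g (m - 1) + g m"
  proof -
    obtain n where n: "m = n + 3" using m(1) by (metis add.commute le_iff_add)
    show ?thesis unfolding n by (simp add: numeral_eq_Suc)
  qed
  moreover have "m - 2 + 2 = m" "m - 3 + 2 = m - 1" using m(1) by auto
  ultimately have "colorable E (I \<union> (A 1 2 \<union> {v 2}) \<union> (A 1 3 \<union> {v 1}) \<union> (A 2 3 \<union> {v 3}) \<union> (\<Union>j\<in>{4..m}. L j))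
      ((\<Sum>j=2..m. g j) + g (m - 1) + 1)"
    by (simp add: algebra_simps)
  then show ?thesis using cover colorable_subset by blast
qed


end

section \<open>Triangle-free graphs without induced \<open>3K\<^sub>2\<close>\<close>

text \<open>The assumptions of this locale are contradictory; this is lemma \<open>inconsistent\<close>.\<close>

locale non_4colorable_graph = graph +
  assumes triangle_free: "\<not> (E x y \<and> E y z \<and> E x z)"
    and no_3K2: "\<not> (E a b \<and> E c d \<and> E e f \<and>
      \<not> E a c \<and> \<not> E a d \<and> \<not> E a e \<and> \<not> E a f \<and> \<not> E b c \<and> \<not> E b d \<and> \<not> E b e \<and> \<not> E b f \<and>
      \<not> E c e \<and> \<not> E c f \<and> \<not> E d e \<and> \<not> E d f)"
    and finite_edges: "finite {v. \<exists>w. E v w}"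
    and not_colorable: "\<not> (\<exists>col :: 'a \<Rightarrow> nat. (\<forall>v. col v < 4) \<and> (\<forall>u v. E u v \<longrightarrow> col u \<noteq> col v))"
begin

definition cycle5 :: "'a \<Rightarrow> 'a \<Rightarrow> 'a \<Rightarrow> 'a \<Rightarrow> 'a \<Rightarrow> bool" where
  "cycle5 a b c d e \<longleftrightarrow> E a b \<and> E b c \<and> E c d \<and> E d e \<and> E e a \<and>
     \<not> E a c \<and> \<not> E a d \<and> \<not> E b d \<and> \<not> E b e \<and> \<not> E c e"

abbreviation anti :: "'a set \<Rightarrow> 'a set \<Rightarrow> bool" where
  "anti \<equiv> anticomplete E"

text \<open>Otherwise the neighbourhoods of \<open>p\<close>, \<open>q\<close> and \<open>r\<close>,
  independent as there are no triangles, and the remaining vertices would be four colour classes.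
  The three vertices need not be distinct.\<close>

lemma edge_missing_three:
  obtains x y where "E x y" "anti {p, q, r} {x, y}"
proof -
  have "\<exists>x y. E x y \<and> anti {p, q, r} {x, y}"
  proof (rule ccontr)
    assume none: "\<not> ?thesis"
    define col :: "'a \<Rightarrow> nat" where
      "col v = (if E p v then 0 else if E q v then 1 else if E r v then 2 else 3)" for v
    have "col u \<noteq> col v" if "E u v" for u v
      using that none triangle_free[of _ u v] by (auto simp: col_def anticomplete_def split: if_splits)
    moreover have "col v < 4" for v by (simp add: col_def)
    ultimately show False using not_colorable by blast
  qed
  then show ?thesis using that by blast
qed

text \<open>
  Among the vertices missing \<open>p\<close> and \<open>q\<close> whose neighbourhood there contains that of \<open>a\<close>,
  one of maximal degree lies on such a cycle together with \<open>b\<close>; it can then be replaced by \<open>a\<close>.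
\<close>

lemma cycle5_through_edge:
  assumes "E p q" "E a b" "anti {p, q} {a, b}"
  obtains x y c where "cycle5 a b x y c" "anti {p, q} {x, y, c}"
proof -
  define N where "N x = {v. E x v \<and> \<not> E p v \<and> \<not> E q v}" for x
  define P where "P s \<longleftrightarrow> \<not> E p s \<and> \<not> E q s \<and> N a \<subseteq> N s" for s
  have fin: "finite (N s)" for s
    by (rule finite_subset[OF _ finite_edges]) (auto simp: N_def commute)
  have "P a" using assms by (auto simp: P_def anticomplete_def)
  moreover have "card (N s) \<le> card {v. \<exists>w. E v w}" for s
    by (rule card_mono[OF finite_edges]) (auto simp: N_def commute)
  ultimately have "\<exists>s. P s \<and> (\<forall>t. P t \<longrightarrow> card (N t) \<le> card (N s))"
    by (intro ex_has_greatest_nat[where b = "Suc (card {v. \<exists>w. E v w})"]) (simp_all add: less_Suc_eq_le)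
  then obtain s where s: "P s" and max: "\<And>t. P t \<Longrightarrow> card (N t) \<le> card (N s)" by blast
  obtain x0 y0 where xy0: "E x0 y0" "anti {p, q, s} {x0, y0}"
    by (rule edge_missing_three)
  \<comment> \<open>Otherwise \<open>pq\<close>, \<open>sc\<close> and \<open>x0y0\<close> form an
    induced 3K2.\<close>
  have meet: "E c x0 \<or> E c y0" if "c \<in> N s" for c
    using no_3K2[of p q s c x0 y0] that s xy0 assms(1)
    by (auto simp: P_def N_def anticomplete_def commute)
  have b: "b \<in> N s" using s assms by (auto simp: P_def N_def anticomplete_def)
  obtain x y where xy: "E x y" "anti {p, q, s} {x, y}" "E b x"
    and meet: "\<And>c. c \<in> N s \<Longrightarrow> E c x \<or> E c y"
  proof (cases "E b x0")
    case True then show ?thesis using that xy0 meet by blast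
  next
    case False
    then have "E b y0" using meet b by blast
    moreover have "E y0 x0" "anti {p, q, s} {y0, x0}"
      using xy0 commute by (auto simp: anticomplete_def)
    ultimately show ?thesis using that meet by blast
  qed
  have notN: "x \<notin> N s" "y \<notin> N s" using xy by (auto simp: N_def anticomplete_def)
  \<comment> \<open>Otherwise \<open>x\<close> would also qualify and have larger degree than
    \<open>s\<close>, as \<open>y\<close> is a further neighbour of \<open>x\<close>.\<close>
  have "\<exists>c\<in>N s. \<not> E c x"
  proof (rule ccontr)
    assume "\<not> ?thesis"
    then have "insert y (N s) \<subseteq> N x"
      using xy commute by (auto simp: N_def anticomplete_def)
    moreover have "P x"
      using calculation s xy by (auto simp: P_def anticomplete_def)
    ultimately show False
      using max[of x] card_mono[OF fin, of "insert y (N s)" x] notN fin by simp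
  qed
  then obtain c where c: "c \<in> N s" "\<not> E c x" "E c y" using meet by blast
  have ax: "\<not> E a x" "\<not> E a y"
    using notN s xy by (auto simp: P_def N_def anticomplete_def)
  have "\<not> E b c" "\<not> E b y"
    using triangle_free[of s b c] triangle_free[of b x y] b c xy by (auto simp: N_def)
  \<comment> \<open>Otherwise \<open>pq\<close>, \<open>ab\<close> and \<open>cy\<close> form an
    induced 3K2. This puts \<open>a\<close> in the place of \<open>s\<close> on the cycle.\<close>
  moreover have "E a c"
    using no_3K2[of p q a b c y] assms xy c calculation ax
    by (auto simp: N_def anticomplete_def commute)
  ultimately have "cycle5 a b x y c"
    using assms xy c ax commute by (auto simp: cycle5_def)
  then show ?thesis
    using that c xy by (auto simp: N_def anticomplete_def)
qed

text \<open>
  In the following lemmas the adjacencies among finitely many named vertices are refuted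
  propositionally. The lists are minimal unsatisfiable sets of instances found with a SAT solver.
\<close>

lemma no_two_cycle5_vertex_twin:
  "\<not> (cycle5 c0 c1 c2 c3 c4 \<and> cycle5 c0 k1 k2 k3 k4 \<and> anti {c1, c2, c3, c4} {k1, k2, k3, k4} \<and>
      E t k1 \<and> E t k4 \<and> anti {t} {c0, c1, c2, c3, c4, k2, k3})"
proof
  assume *: "cycle5 c0 c1 c2 c3 c4 \<and> cycle5 c0 k1 k2 k3 k4 \<and> anti {c1, c2, c3, c4} {k1, k2, k3, k4} \<and>
      E t k1 \<and> E t k4 \<and> anti {t} {c0, c1, c2, c3, c4, k2, k3}"
  \<comment> \<open>The vertex \<open>t\<close> is a twin of \<open>c0\<close> for the second cycle
    but misses the first. Three pairs of anticomplete edges supply further 5-cycles for the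
    refutation.\<close>
  have "E k3 k4" "E c3 c4" "anti {k3, k4} {c3, c4}"
    using * commute by (auto simp: cycle5_def anticomplete_def)
  then obtain x y z where xyz: "cycle5 c3 c4 x y z" "anti {k3, k4} {x, y, z}"
    by (rule cycle5_through_edge)
  have "E c0 k4" "E c2 c3" "anti {c0, k4} {c2, c3}"
    using * commute by (auto simp: cycle5_def anticomplete_def)
  then obtain u v w where uvw: "cycle5 c2 c3 u v w" "anti {c0, k4} {u, v, w}"
    by (rule cycle5_through_edge)
  have "E c0 c1" "E k2 k3" "anti {c0, c1} {k2, k3}"
    using * commute by (auto simp: cycle5_def anticomplete_def)
  then obtain p q r where pqr: "cycle5 k2 k3 p q r" "anti {c0, c1} {p, q, r}"
    by (rule cycle5_through_edge)
  show False
    using * xyz uvw pqr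
    no_3K2[of c0 c1 k2 r v w] no_3K2[of c0 c4 k2 k3 u v] no_3K2[of c0 k1 c2 c3 q r]
    no_3K2[of c1 c2 k1 p k4 r] no_3K2[of c1 u c4 w k4 t] no_3K2[of c4 w k3 k4 y u]
    no_3K2[of c0 c1 c3 u p q] no_3K2[of c0 c1 c3 u q r] no_3K2[of c0 c4 c2 w k3 p]
    no_3K2[of c0 k4 k2 r u v] no_3K2[of c2 w c4 x k4 t] no_3K2[of c2 w k3 k4 x u]
    no_3K2[of c0 c1 k2 r t w] no_3K2[of c0 k1 c2 r k3 u] no_3K2[of c0 c1 c3 u k2 r]
    no_3K2[of c0 c1 c3 u k3 p] no_3K2[of c0 k4 c2 w k2 r] no_3K2[of c0 k4 c3 u k2 r]
    no_3K2[of c1 c2 k3 k4 y z] no_3K2[of c2 w c4 x k3 k4] no_3K2[of c2 c3 k1 q k3 k4]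
    no_3K2[of c0 c1 c3 u k2 k3] no_3K2[of c0 k4 c2 c3 k2 r] no_3K2[of c1 c2 c4 x k4 t]
    no_3K2[of c1 c2 k1 t k3 p] no_3K2[of c1 c2 k2 r k4 t] no_3K2[of c3 u k3 k4 x y]
    no_3K2[of c2 c3 k2 k3 t x] no_3K2[of c1 c2 c4 v k4 t] no_3K2[of c3 c4 k2 w k4 t]
    no_3K2[of c0 k4 c3 u x w] no_3K2[of c0 k4 c2 c3 k2 x] no_3K2[of c2 c3 k3 k4 x y]
    no_3K2[of c0 c1 k3 p t r] no_3K2[of c0 c1 c3 r k3 p] no_3K2[of c0 k4 c2 w k2 u]
    no_3K2[of c1 z c4 x k3 k4] no_3K2[of c0 c1 k2 r t p] no_3K2[of c0 k4 c3 u k2 w]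
    no_3K2[of c0 c1 c3 p k2 r] no_3K2[of c0 c1 c3 q k2 k3] no_3K2[of c0 k4 c2 c3 k2 v]
    no_3K2[of c1 y c3 c4 k3 k4] triangle_free[of c1 x u] triangle_free[of t w p]
    triangle_free[of c1 c2 x] triangle_free[of c1 u v] triangle_free[of c2 c3 p]
    triangle_free[of c2 c3 r] triangle_free[of c2 x y] triangle_free[of c2 y w]
    triangle_free[of c2 w r] triangle_free[of c2 p q] triangle_free[of c3 c4 p]
    triangle_free[of c3 u r] triangle_free[of c4 x w] triangle_free[of k1 t u]
    triangle_free[of k2 k3 u] triangle_free[of k2 k3 w] triangle_free[of k2 u r]
    triangle_free[of k3 u p] triangle_free[of k3 v w] triangle_free[of k4 t r]
    triangle_free[of k4 q r] triangle_free[of t u v] triangle_free[of u v r] triangle_free[of u p q]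
    triangle_free[of u q r] triangle_free[of v w r] triangle_free[of c0 c4 x]
    triangle_free[of c1 c2 w] triangle_free[of c2 c3 z] triangle_free[of c3 c4 u]
    triangle_free[of k1 k2 r] triangle_free[of k3 k4 p]
    unfolding cycle5_def anticomplete_simps
    by (simp (no_asm_use) only: commute, sat)
qed

text \<open>A 5-cycle through \<open>k1\<close> and \<open>k2\<close> that misses \<open>c1\<close>
  and \<open>c2\<close> has a vertex \<open>z\<close> next to \<open>k1\<close>; the listed
  instances force \<open>z\<close> to be a twin of \<open>c0\<close> as just excluded.\<close>

lemma no_two_cycle5_vertex:
  "\<not> (cycle5 c0 c1 c2 c3 c4 \<and> cycle5 c0 k1 k2 k3 k4 \<and> anti {c1, c2, c3, c4} {k1, k2, k3, k4})"
proof
  assume *: "cycle5 c0 c1 c2 c3 c4 \<and> cycle5 c0 k1 k2 k3 k4 \<and> anti {c1, c2, c3, c4} {k1, k2, k3, k4}"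
  have "E c1 c2" "E k1 k2" "anti {c1, c2} {k1, k2}"
    using * by (auto simp: cycle5_def anticomplete_def)
  then obtain x y z where xyz: "cycle5 k1 k2 x y z" "anti {c1, c2} {x, y, z}"
    by (rule cycle5_through_edge)
  show False
    using * xyz
    no_two_cycle5_vertex_twin[of c0 c4 c3 c2 c1 k4 k3 k2 k1 z] no_3K2[of c1 c2 k3 k4 x y]
    no_3K2[of c0 c1 c3 z k2 k3] no_3K2[of c1 c2 k1 z k3 k4] no_3K2[of c1 c2 c4 z k2 k3]
    no_3K2[of c1 c2 k1 z k4 x] no_3K2[of c1 c2 k1 k2 k4 y] triangle_free[of k3 k4 z]
    triangle_free[of k3 y z] triangle_free[of c0 k1 z] triangle_free[of k2 k3 x]
    unfolding cycle5_def anticomplete_simps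
    by (simp (no_asm_use) only: commute, sat)
qed

text \<open>Whatever the other adjacencies of \<open>u\<close> and \<open>v\<close> to the cycles,
  an edge \<open>uv\<close> would yield a triangle, an induced 3K2 or two 5-cycles that share only
  \<open>u\<close> or only \<open>v\<close>.\<close>

lemma no_edge_between_cycle5_neighbours:
  assumes "cycle5 c0 c1 c2 c3 c4" "cycle5 k0 k1 k2 k3 k4"
    and "anti {c0, c1, c2, c3, c4} {k0, k1, k2, k3, k4}" "E c0 u" "E k0 v"
  shows "\<not> E u v"
  using assms
    no_two_cycle5_vertex[of v k0 k4 k3 k2 u c3 c2 c1]
    no_two_cycle5_vertex[of v k0 k4 k3 k2 c4 c3 c2 c1]
    no_two_cycle5_vertex[of u k1 k2 k3 k4 c3 c2 c1 c0]
    no_two_cycle5_vertex[of v c1 c2 c3 c4 k0 k1 k2 k3]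
    no_two_cycle5_vertex[of u k1 k2 k3 k4 c2 c3 c4 c0]
    no_two_cycle5_vertex[of v c2 c1 c0 c4 k2 k3 k4 k0]
    no_two_cycle5_vertex[of u k1 k0 k4 k3 c3 c2 c1 c0]
    no_two_cycle5_vertex[of u k1 k0 k4 k3 c2 c3 c4 c0]
    no_two_cycle5_vertex[of v c4 c0 c1 c2 k3 k2 k1 k0]
    no_two_cycle5_vertex[of u k2 k1 k0 k4 c3 c2 c1 c0]
    no_two_cycle5_vertex[of u c0 c4 c3 c2 k2 k1 k0 k4]
    no_two_cycle5_vertex[of v k0 k1 k2 k3 c3 c4 c0 c1]
    no_two_cycle5_vertex[of v k0 k4 k3 k2 c3 c4 c0 c1] no_3K2[of c1 c2 k1 k2 u v]
    no_3K2[of c1 c2 k3 k4 u v] no_3K2[of c3 c4 k1 k2 u v] no_3K2[of c3 c4 k3 k4 u v]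
    no_3K2[of c1 c2 k1 k2 k4 u] no_3K2[of c1 c2 c4 v k1 k2] no_3K2[of c0 c1 c3 v k1 k2]
    no_3K2[of c3 c4 k1 k2 k4 u] no_3K2[of c3 c4 k0 k1 k3 u] no_3K2[of c1 c2 k1 u k3 k4]
    no_3K2[of c1 v c3 c4 k1 k2] no_3K2[of c3 c4 k1 u k3 k4] no_3K2[of c3 c4 k0 k4 k2 u]
    no_3K2[of c0 c4 c2 v k1 k2] no_3K2[of c1 c2 k0 k4 k2 u] no_3K2[of c0 c4 c2 v k3 k4]
    no_3K2[of c0 c1 c3 v k3 k4] no_3K2[of c1 c2 c4 v k3 k4] no_3K2[of c1 c2 k0 k1 k3 u]
    no_3K2[of c0 c1 k0 v k2 k3] no_3K2[of c0 c4 k0 v k2 k3] no_3K2[of c0 u c2 c3 k0 k1]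
    no_3K2[of c0 u c2 c3 k0 k4] no_3K2[of c0 u c2 c3 k2 k3] no_3K2[of c2 c3 k0 v k2 k3]
    triangle_free[of c1 c2 v] triangle_free[of c2 c3 u] triangle_free[of c3 c4 v]
    triangle_free[of k1 k2 u] triangle_free[of k2 k3 v] triangle_free[of k3 k4 u]
    triangle_free[of c0 c1 u] triangle_free[of c0 c4 u] triangle_free[of c0 u v]
    triangle_free[of k0 k1 v] triangle_free[of k0 k4 v] triangle_free[of k0 u v]
  unfolding cycle5_def anticomplete_simps
  by (simp (no_asm_use) only: commute, sat)

text \<open>Here the neighbours of the two cycles form separate parts, coloured with the same three colours.\<close>

lemma no_two_cycle5_apart:
  "\<not> (cycle5 c0 c1 c2 c3 c4 \<and> cycle5 k0 k1 k2 k3 k4 \<and>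
      anti {c0, c1, c2, c3, c4} {k0, k1, k2, k3, k4})"
proof
  assume *: "cycle5 c0 c1 c2 c3 c4 \<and> cycle5 k0 k1 k2 k3 k4 \<and>
    anti {c0, c1, c2, c3, c4} {k0, k1, k2, k3, k4}"
  have **: "cycle5 c1 c2 c3 c4 c0" "cycle5 k1 k2 k3 k4 k0"
    "anti {c1, c2, c3, c4, c0} {k1, k2, k3, k4, k0}"
    using * commute by (auto simp: cycle5_def anticomplete_def)
  \<comment> \<open>The first two classes are independent by the previous lemma, applied to the
    cycles and to their rotations. An edge in the last class would form an induced 3K2 with
    \<open>c0c1\<close> and \<open>k0k1\<close>.\<close>
  define col :: "'a \<Rightarrow> nat" where
    "col v = (if E c0 v \<or> E k0 v then 0 else if E c1 v \<or> E k1 v then 1 else 2)" for v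
  have "col u \<noteq> col v" if "E u v" for u v
  proof -
    have "E v u" using that commute by blast
    have 0: "\<not> (E c0 u \<and> E k0 v)" "\<not> (E c0 v \<and> E k0 u)"
      using no_edge_between_cycle5_neighbours[of c0 c1 c2 c3 c4 k0 k1 k2 k3 k4] * that \<open>E v u\<close> by blast+
    have 1: "\<not> (E c1 u \<and> E k1 v)" "\<not> (E c1 v \<and> E k1 u)"
      using no_edge_between_cycle5_neighbours[OF **] that \<open>E v u\<close> by blast+
    have 2: "E c0 u \<or> E k0 u \<or> E c1 u \<or> E k1 u \<or> E c0 v \<or> E k0 v \<or> E c1 v \<or> E k1 v"
      using no_3K2[of c0 c1 k0 k1 u v] that *  by (auto simp: cycle5_def anticomplete_def)
    have 3: "\<not> (E w u \<and> E w v)" for w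
      using triangle_free[of w u v] that by blast
    show ?thesis
      using 0 1 2 3[of c0] 3[of c1] 3[of k0] 3[of k1] by (auto simp: col_def)
  qed
  moreover have "col v < 4" for v by (simp add: col_def)
  ultimately show False using not_colorable by blast
qed

text \<open>\<open>x\<close> and \<open>z\<close> are twins of \<open>c0\<close> for the given
  cycle. The new cycle comes from the edge \<open>c2c3\<close>; those from \<open>c3c4\<close> and
  \<open>c1c2\<close> force its other adjacencies, since two anticomplete 5-cycles are
  excluded.\<close>

lemma cycle5_edge_link:
  assumes cyc: "cycle5 c0 c1 c2 c3 c4" and ab: "E a b" "anti {c0, c1, c2, c3, c4} {a, b}"
  obtains x y z where "cycle5 a b x y z" "E c1 x" "E c4 x" "E c1 z" "E c4 z"
    "anti {x, z} {c0, c2, c3}" "anti {y} {c0, c1, c2, c3, c4}"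
proof -
  have "E c2 c3" "anti {c2, c3} {a, b}" and "E c3 c4" "anti {c3, c4} {a, b}"
    and "E c1 c2" "anti {c1, c2} {a, b}"
    using cyc ab by (auto simp: cycle5_def anticomplete_def)
  obtain x y z where xyz: "cycle5 a b x y z" "anti {c2, c3} {x, y, z}"
    by (rule cycle5_through_edge[OF \<open>E c2 c3\<close> ab(1) \<open>anti {c2, c3} {a, b}\<close>])
  obtain x' y' z' where xyz': "cycle5 a b x' y' z'" "anti {c3, c4} {x', y', z'}"
    by (rule cycle5_through_edge[OF \<open>E c3 c4\<close> ab(1) \<open>anti {c3, c4} {a, b}\<close>])
  obtain x'' y'' z'' where xyz'': "cycle5 a b x'' y'' z''" "anti {c1, c2} {x'', y'', z''}"
    by (rule cycle5_through_edge[OF \<open>E c1 c2\<close> ab(1) \<open>anti {c1, c2} {a, b}\<close>])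
  have "E c1 x \<and> E c4 x \<and> E c1 z \<and> E c4 z \<and> \<not> E x c0 \<and> \<not> E z c0 \<and> \<not> E y c0 \<and> \<not> E y c1 \<and> \<not> E y c4"
    using cyc ab xyz xyz' xyz''
    no_two_cycle5_apart[of c0 c1 c2 c3 c4 a z y x' b]
    no_two_cycle5_apart[of c0 c1 c2 c3 c4 a z y x'' b]
    no_two_cycle5_apart[of c0 c1 c2 c3 c4 a z' y x b]
    no_two_cycle5_apart[of c0 c1 c2 c3 c4 a z'' y x b]
    no_two_cycle5_apart[of c0 c1 c2 c3 c4 b a z y'' x]
    no_two_cycle5_vertex[of c1 c0 c4 c3 c2 z' a b x']
    no_two_cycle5_vertex[of c4 c0 c1 c2 c3 z'' a b x'']
    no_two_cycle5_vertex[of c0 c4 c3 c2 c1 x b a z] no_3K2[of c1 c2 x y x'' y'']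
    no_3K2[of c1 c2 y z y'' z''] no_3K2[of c3 c4 x y x' y'] no_3K2[of c3 c4 y z y' z']
    no_3K2[of c3 c4 a z' x y''] no_3K2[of c2 z' c4 z b x''] no_3K2[of c1 c2 x z'' z x'']
    no_3K2[of c3 c4 b x' z y''] no_3K2[of c2 x' c4 x a z''] no_3K2[of c1 x c3 c4 a z']
    no_3K2[of c1 c2 c4 x a z''] no_3K2[of c0 x' c2 c3 a z] no_3K2[of c1 z c3 c4 b x']
    no_3K2[of c0 z' c2 c3 b x] no_3K2[of c1 c2 c4 z b x''] no_3K2[of c0 x c2 c3 a z']
    no_3K2[of c1 c2 a z x'' y''] no_3K2[of c1 c2 b x y'' z''] no_3K2[of c2 c3 a z' x y]
    no_3K2[of c2 c3 a z'' x y] no_3K2[of c2 c3 b x' y z] no_3K2[of c2 c3 b x'' y z]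
    no_3K2[of c1 c2 a z'' y x''] no_3K2[of c3 c4 b x' y z'] no_3K2[of c1 c2 b x'' y z'']
    no_3K2[of c2 c3 a z x y''] no_3K2[of c3 c4 a z' y x'] no_3K2[of c2 c3 b x z y'']
    no_3K2[of c1 y c3 y'' a b] no_3K2[of c3 c4 a b y y'] no_3K2[of c0 y'' c2 c3 a b]
    no_3K2[of c1 c2 c4 y a b] no_3K2[of c1 z' c3 c4 b x'] no_3K2[of c0 c1 c3 y'' a b]
    no_3K2[of c1 x' c3 c4 a z'] no_3K2[of c1 c2 c4 z'' b x''] no_3K2[of c1 c2 c4 x'' a z'']
    no_3K2[of c0 z c2 c3 b x] no_3K2[of c1 c2 a b y y''] no_3K2[of c0 x c2 c3 a z]
    no_3K2[of c0 y c2 c3 a b] no_3K2[of c1 c2 c4 y'' a b] triangle_free[of c0 c1 z']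
    triangle_free[of c0 c4 x] triangle_free[of c0 c4 z] triangle_free[of c0 c4 x'']
    triangle_free[of c0 c4 z''] triangle_free[of c0 x'' y''] triangle_free[of c0 y'' z'']
    triangle_free[of c1 c2 x'] triangle_free[of c1 c2 z'] triangle_free[of c1 x y]
    triangle_free[of c1 y z] triangle_free[of c3 c4 x''] triangle_free[of c3 c4 z'']
    triangle_free[of c3 x'' y''] triangle_free[of c3 y'' z''] triangle_free[of x y z']
    triangle_free[of x y z''] triangle_free[of x y' z'] triangle_free[of x y'' z'']
    triangle_free[of y z x'] triangle_free[of y z x''] triangle_free[of y z y'']
    triangle_free[of y y'' z''] triangle_free[of z x' y'] triangle_free[of z x'' y'']
    triangle_free[of x' y'' z''] triangle_free[of z' x'' y''] triangle_free[of a z z']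
    triangle_free[of a z z''] triangle_free[of b x x'] triangle_free[of b x x'']
    unfolding cycle5_def anticomplete_simps
    by (simp (no_asm_use) only: commute, sat)
  then show ?thesis
    using that[OF xyz(1)] xyz(2) commute by (auto simp: anticomplete_def)
qed

text \<open>Rotating the cycle gives twins of \<open>c0\<close>, \<open>c1\<close>,
  \<open>c2\<close> and \<open>c3\<close> attached to \<open>ab\<close>; these four already
  conflict.\<close>

lemma no_cycle5_apart_edge:
  assumes cyc: "cycle5 c0 c1 c2 c3 c4" and ab: "E a b" "anti {c0, c1, c2, c3, c4} {a, b}"
  shows False
proof -
  have rot: "cycle5 c1 c2 c3 c4 c0" "anti {c1, c2, c3, c4, c0} {a, b}"
    "cycle5 c2 c3 c4 c0 c1" "anti {c2, c3, c4, c0, c1} {a, b}"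
    "cycle5 c3 c4 c0 c1 c2" "anti {c3, c4, c0, c1, c2} {a, b}"
    using cyc ab commute by (auto simp: cycle5_def anticomplete_def)
  obtain x0 y0 z0 where 0: "cycle5 a b x0 y0 z0" "E c1 x0" "E c4 x0" "E c1 z0" "E c4 z0"
    "anti {x0, z0} {c0, c2, c3}" "anti {y0} {c0, c1, c2, c3, c4}"
    by (rule cycle5_edge_link[OF cyc ab])
  obtain x1 y1 z1 where 1: "cycle5 a b x1 y1 z1" "E c2 x1" "E c0 x1" "E c2 z1" "E c0 z1"
    "anti {x1, z1} {c1, c3, c4}" "anti {y1} {c1, c2, c3, c4, c0}"
    by (rule cycle5_edge_link[OF rot(1) ab(1) rot(2)])
  obtain x2 y2 z2 where 2: "cycle5 a b x2 y2 z2" "E c3 x2" "E c1 x2" "E c3 z2" "E c1 z2"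
    "anti {x2, z2} {c2, c4, c0}" "anti {y2} {c2, c3, c4, c0, c1}"
    by (rule cycle5_edge_link[OF rot(3) ab(1) rot(4)])
  obtain x3 y3 z3 where 3: "cycle5 a b x3 y3 z3" "E c4 x3" "E c2 x3" "E c4 z3" "E c2 z3"
    "anti {x3, z3} {c3, c0, c1}" "anti {y3} {c3, c4, c0, c1, c2}"
    by (rule cycle5_edge_link[OF rot(5) ab(1) rot(6)])
  show False
    using cyc ab 0 1 2 3
    no_3K2[of c0 z1 c3 z2 y3 z3] no_3K2[of c3 z2 b x0 y3 z3] no_3K2[of c0 z1 c3 z2 b x0]
    no_3K2[of c0 z1 c3 z2 b x3] triangle_free[of x0 z1 y3] triangle_free[of z2 x3 y3]
    triangle_free[of c1 x0 z2] triangle_free[of c2 z1 x3] triangle_free[of c4 x0 z3]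
    triangle_free[of a z1 z2] triangle_free[of a z1 z3] triangle_free[of a z2 z3]
    unfolding cycle5_def anticomplete_simps
    by (simp (no_asm_use) only: commute, sat)
qed

lemma inconsistent: False
proof -
  obtain p q where "E p q" by (rule edge_missing_three)
  obtain a b where ab: "E a b" "anti {p, q, q} {a, b}" by (rule edge_missing_three)
  then obtain x y z where "cycle5 a b x y z" "anti {p, q} {x, y, z}"
    using cycle5_through_edge[OF \<open>E p q\<close> ab(1)] by (auto simp: anticomplete_def)
  with ab \<open>E p q\<close> commute show False
    using no_cycle5_apart_edge[of a b x y z p q] by (auto simp: anticomplete_def)
qed


end

section \<open>The recursive bound\<close>

text \<open>Allows the main induction to use the exact clique number instead of an upper bound. For
  small \<open>m\<close> the two sides fall under different clauses of the definition.\<close>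

lemma f_bound_Suc_mono: "p \<ge> 2 \<Longrightarrow> f_bound p m \<le> f_bound p (Suc m)"
proof (induction p arbitrary: m rule: nat_induct_at_least)
  case base
  show ?case by (simp add: f_bound.simps[of 2])
next
  case (Suc p)
  consider "m = 0" | "m = 1" | "m = 2" | "m \<ge> 3" by linarith
  then show ?case
  proof cases
    case 1 then show ?thesis by (simp add: f_bound.simps)
  next
    case 2
    then have "f_bound (Suc p) (Suc m) = 2 * p" using Suc.hyps f_bound_two[of "Suc p"] by (simp add: numeral_2_eq_2)
    then show ?thesis using 2 Suc.hyps f_bound_one[of "Suc p"] by simp
  next
    case 3
    have "p \<le> 2 * f_bound p 2"
      using Suc.hyps f_bound_base[of 2] f_bound_two[of p] by (cases "p = 2") auto
    moreover have "f_bound (Suc p) 3 = f_bound p 2 + f_bound p 3 + f_bound p 2 + 1"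
      using Suc.hyps f_bound_rec[of 3 "Suc p"] by (simp add: numeral_3_eq_3 numeral_2_eq_2)
    moreover have "f_bound p 2 \<le> f_bound p 3" using Suc.IH[of 2] by (simp add: numeral_3_eq_3 numeral_2_eq_2)
    moreover have "f_bound (Suc p) 2 = 2 * p" using Suc.hyps f_bound_two[of "Suc p"] by simp
    ultimately show ?thesis using 3 Suc.hyps f_bound_two[of p] f_bound_base[of 2]
      by (cases "p = 2") (simp_all add: numeral_3_eq_3[symmetric])
  next
    case 4
    have "f_bound p (m - 1) \<le> f_bound p m" using Suc.IH[of "m - 1"] 4 by simp
    then show ?thesis using 4 Suc.hyps f_bound_rec[of m "Suc p"] f_bound_rec[of "Suc m" "Suc p"] by simp
  qed
qed

lemma f_bound_mono: "p \<ge> 2 \<Longrightarrow> m \<le> n \<Longrightarrow> f_bound p m \<le> f_bound p n"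
  using f_bound_Suc_mono lift_Suc_mono_le[of "f_bound p"] by blast

context graph
begin

lemma no_triangle_if_cliques_le_2:
  assumes "\<And>C. C \<subseteq> S \<Longrightarrow> clique E C \<Longrightarrow> card C \<le> 2" "x \<in> S" "y \<in> S" "z \<in> S"
  shows "\<not> (E x y \<and> E y z \<and> E x z)"
proof
  assume *: "E x y \<and> E y z \<and> E x z"
  then have "x \<noteq> y" "y \<noteq> z" "x \<noteq> z" using irrefl by auto
  moreover have "clique E {x, y, z}" using * commute by (auto simp: clique_def)
  ultimately show False using assms(1)[of "{x, y, z}"] assms(2-4) by simp
qed

lemma colorable_4_if_triangle_free:
  assumes "finite S" "\<not> induced_matching E S 3"
    and cliques: "\<And>C. C \<subseteq> S \<Longrightarrow> clique E C \<Longrightarrow> card C \<le> 2"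
  shows "colorable E S 4"
proof (rule ccontr)
  assume not_col: "\<not> colorable E S 4"
  \<comment> \<open>Vertices outside \<open>S\<close> become isolated, so that a counterexample on
    \<open>S\<close> becomes one on the whole type.\<close>
  define E' where "E' u v \<longleftrightarrow> u \<in> S \<and> v \<in> S \<and> E u v" for u v
  interpret non_4colorable_graph E'
  proof
    show "E' y x" if "E' x y" for x y using that sym by (auto simp: E'_def)
    show "\<not> E' x x" for x using irrefl by (simp add: E'_def)
    show "\<not> (E' x y \<and> E' y z \<and> E' x z)" for x y z
      using no_triangle_if_cliques_le_2[OF cliques, of S x y z] by (auto simp: E'_def)
    show "\<not> (E' a b \<and> E' c d \<and> E' e f \<and>
      \<not> E' a c \<and> \<not> E' a d \<and> \<not> E' a e \<and> \<not> E' a f \<and> \<not> E' b c \<and> \<not> E' b d \<and> \<not> E' b e \<and> \<not> E' b f \<and>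
      \<not> E' c e \<and> \<not> E' c f \<and> \<not> E' d e \<and> \<not> E' d f)" for a b c d e f
    proof
      assume "E' a b \<and> E' c d \<and> E' e f \<and>
        \<not> E' a c \<and> \<not> E' a d \<and> \<not> E' a e \<and> \<not> E' a f \<and> \<not> E' b c \<and> \<not> E' b d \<and> \<not> E' b e \<and> \<not> E' b f \<and>
        \<not> E' c e \<and> \<not> E' c f \<and> \<not> E' d e \<and> \<not> E' d f"
      then have "induced_matching E S 3"
        unfolding induced_matching_def
        by (intro exI[of _ "(!) [a, c, e]"] exI[of _ "(!) [b, d, f]"])
          (auto simp: E'_def anticomplete_def numeral_3_eq_3 less_Suc_eq commute)
      then show False using assms(2) by blast
    qed
    show "finite {v. \<exists>w. E' v w}" by (rule finite_subset[OF _ assms(1)]) (auto simp: E'_def)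
    show "\<not> (\<exists>col :: 'a \<Rightarrow> nat. (\<forall>v. col v < 4) \<and> (\<forall>u v. E' u v \<longrightarrow> col u \<noteq> col v))"
      using not_col unfolding colorable_def E'_def by blast
  qed
  show False by (rule inconsistent)
qed

text \<open>Without triangles each of the two neighbourhoods is independent and costs one
  colour.\<close>

lemma colorable_remove_edge_neighbours:
  assumes "\<And>C. C \<subseteq> S \<Longrightarrow> clique E C \<Longrightarrow> card C \<le> 2" "a \<in> S" "b \<in> S"
    and "colorable E {x \<in> S. \<not> E a x \<and> \<not> E b x} k"
  shows "colorable E S (k + 2)"
proof -
  have "colorable E {x \<in> S. E c x} 1" if "c \<in> S" for c
    using no_triangle_if_cliques_le_2[OF assms(1) that]
    by (intro colorable_independent) (auto simp: anticomplete_def)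
  then have "colorable E ({x \<in> S. \<not> E a x \<and> \<not> E b x} \<union> ({x \<in> S. E a x} \<union> {x \<in> S. E b x})) (k + (1 + 1))"
    using assms(2-4) by (intro colorable_Un) auto
  then show ?thesis by (rule colorable_subset[OF colorable_mono]) auto
qed

theorem colorable_f_bound:
  assumes "p \<ge> 2" "finite S" "\<not> induced_matching E S p" "wheel_free E S"
    and "\<And>C. C \<subseteq> S \<Longrightarrow> clique E C \<Longrightarrow> card C \<le> m"
  shows "colorable E S (f_bound p m)"
  using assms
proof (induction p arbitrary: S m rule: less_induct)
  case (less p)
  define w where "w = Max (card ` {C. C \<subseteq> S \<and> clique E C})"
  have fin: "finite (card ` {C. C \<subseteq> S \<and> clique E C})" using less.prems(2) by simp
  have w_max: "card C \<le> w" if "C \<subseteq> S" "clique E C" for C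
    unfolding w_def using that by (intro Max_ge[OF fin]) auto
  have "{} \<in> {C. C \<subseteq> S \<and> clique E C}" by (simp add: clique_def)
  then have "w \<in> card ` {C. C \<subseteq> S \<and> clique E C}"
    unfolding w_def using Max_in[OF fin] by blast
  then obtain K where K: "K \<subseteq> S" "clique E K" "card K = w" by auto
  have "w \<le> m" using less.prems(5)[OF K(1,2)] K(3) by simp
  have rest: "\<not> induced_matching E T (p - 1)"
    if "T \<subseteq> S" "u \<in> S" "v \<in> S" "E u v" "anticomplete E {u, v} T" for T u v
    using induced_matching_add_edge[OF _ that, of "p - 1"] less.prems(1,3) by auto
  have wheel_sub: "wheel_free E T" if "T \<subseteq> S" for T
    using less.prems(4) that unfolding wheel_free_def by blast
  have IH: "colorable E T (f_bound (p - 1) k)"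
    if "p \<ge> 3" "T \<subseteq> S" "u \<in> S" "v \<in> S" "E u v" "anticomplete E {u, v} T"
      "\<And>C. C \<subseteq> T \<Longrightarrow> clique E C \<Longrightarrow> card C \<le> k" for T u v k
    using that rest[of T u v] wheel_sub[of T] finite_subset[OF _ less.prems(2)]
    by (intro less.IH) auto
  have independent: "colorable E T 1"
    if "p = 2" "T \<subseteq> S" "u \<in> S" "v \<in> S" "E u v" "anticomplete E {u, v} T" for T u v
    using rest[of T u v] that by (intro colorable_independent independent_if_no_induced_matching) auto
  consider "w = 0" | "w = 1" | "w = 2" | "w \<ge> 3" by linarith
  then have "colorable E S (f_bound p w)"
  proof cases
    case 1
    have "S = {}" using w_max[of "{_}"] 1 by (auto simp: clique_def)
    then show ?thesis by (simp add: colorable_empty)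
  next
    case 2
    have "\<not> E u v" if "u \<in> S" "v \<in> S" for u v
    proof
      assume "E u v"
      then have "u \<noteq> v" "clique E {u, v}" using irrefl commute by (auto simp: clique_def)
      then show False using w_max[of "{u, v}"] that 2 by simp
    qed
    then show ?thesis
      using 2 f_bound_one[of p] colorable_independent[of E S] by (simp add: anticomplete_def)
  next
    case 3
    then obtain a b where ab: "K = {a, b}" "a \<noteq> b" using K(3) by (auto simp: card_2_iff)
    have abS: "a \<in> S" "b \<in> S" "E a b" using ab K by (auto simp: clique_def)
    let ?R = "{x \<in> S. \<not> E a x \<and> \<not> E b x}"
    have R: "?R \<subseteq> S" "anticomplete E {a, b} ?R" by (auto simp: anticomplete_def)
    have remove: "colorable E S (k + 2)" if "colorable E ?R k" for k
      using colorable_remove_edge_neighbours[of S a b k] w_max 3 abS that by blast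
    consider "p = 2" | "p = 3" | "p \<ge> 4" using less.prems(1) by linarith
    then show ?thesis
    proof cases
      case 1
      then have "colorable E S (1 + 2)" using independent[OF _ R(1) abS R(2)] remove by blast
      then show ?thesis using 3 1 f_bound_base[of 2] by (simp add: numeral_3_eq_3)
    next
      case 2
      \<comment> \<open>Removing neighbourhoods would give only \<open>f_bound 2 2 + 2 = 5\<close>
        colours, one more than \<open>f_bound 3 2 = 4\<close>; hence the separate treatment of
        triangle-free graphs.\<close>
      then show ?thesis
        using colorable_4_if_triangle_free[of S] less.prems(2,3) w_max 3 f_bound_two[of 3] by simp
    next
      case p: 3
      have "colorable E ?R (f_bound (p - 1) 2)"
        by (rule IH[OF _ R(1) abS R(2)]) (use p w_max 3 in auto)
      then have "colorable E S (f_bound (p - 1) 2 + 2)" by (rule remove)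
      moreover have "f_bound p 2 = f_bound (p - 1) 2 + 2"
        using p f_bound_two[of p] f_bound_two[of "p - 1"] by simp
      ultimately show ?thesis using 3 by simp
    qed
  next
    case 4
    show ?thesis
    proof (cases "p = 2")
      case True
      \<comment> \<open>With one colour per class the total is
        \<open>(w - 1) + 1 + 1 = w + 1\<close>.\<close>
      have "colorable E S ((\<Sum>j=2..w. 1) + 1 + 1)"
        by (rule colorable_layers[OF less.prems(2,4) 4 w_max K, of "\<lambda>_. 1"])
          (use independent True in auto)
      then show ?thesis using True 4 f_bound_base[of w] by simp
    next
      case False
      have "colorable E S ((\<Sum>j=2..w. f_bound (p - 1) j) + f_bound (p - 1) (w - 1) + 1)"
      proof (rule colorable_layers[OF less.prems(2,4) 4 w_max K])
        fix k :: nat assume "k \<ge> 2"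
        then show "1 \<le> f_bound (p - 1) k"
          using f_bound_mono[of "p - 1" 1 k] f_bound_one[of "p - 1"] less.prems(1) False by simp
      qed (use IH False less.prems(1) in auto)
      then show ?thesis using False 4 less.prems(1) f_bound_rec[of w p] by simp
    qed
  qed
  then show ?case
    by (rule colorable_mono) (rule f_bound_mono[OF less.prems(1) \<open>w \<le> m\<close>])
qed

end

section \<open>From forbidden induced subgraphs to forbidden configurations\<close>

lemma pK2_arc_iff:
  assumes "u < 2 * p" "v < 2 * p"
  shows "(u, v) \<in> parcs (pK2 p) \<longleftrightarrow> u div 2 = v div 2 \<and> u \<noteq> v"
proof
  assume "(u, v) \<in> parcs (pK2 p)"
  then show "u div 2 = v div 2 \<and> u \<noteq> v" by (auto simp: pK2_def)
next
  assume *: "u div 2 = v div 2 \<and> u \<noteq> v"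
  then have "(u, v) \<in> {(2 * (u div 2), 2 * (u div 2) + 1), (2 * (u div 2) + 1, 2 * (u div 2))}"
    by (auto; presburger)
  moreover have "u div 2 < p" using assms by auto
  ultimately show "(u, v) \<in> parcs (pK2 p)" unfolding pK2_def by auto
qed

lemma embedding_if_induced_matching:
  assumes "pair_graph G" "induced_matching (\<lambda>u v. (u, v) \<in> parcs G) (pverts G) p"
  shows "\<exists>h. inj_on h (pverts (pK2 p)) \<and> h ` pverts (pK2 p) \<subseteq> pverts G \<and>
    (\<forall>u\<in>pverts (pK2 p). \<forall>v\<in>pverts (pK2 p). (h u, h v) \<in> parcs G \<longleftrightarrow> (u, v) \<in> parcs (pK2 p))"
proof -
  interpret pair_graph G by fact
  obtain a b where ab: "\<And>i. i < p \<Longrightarrow> a i \<in> pverts G \<and> b i \<in> pverts G \<and> (a i, b i) \<in> parcs G"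
    and anti: "\<And>i j. i < p \<Longrightarrow> j < p \<Longrightarrow> i \<noteq> j \<Longrightarrow>
      anticomplete (\<lambda>u v. (u, v) \<in> parcs G) {a i, b i} {a j, b j}"
    using assms(2) unfolding induced_matching_def by blast
  define h where "h n = (if even n then a (n div 2) else b (n div 2))" for n
  have ba: "(b i, a i) \<in> parcs G" if "i < p" for i
    using ab[OF that] arcs_symmetric by auto
  have adj: "(h u, h v) \<in> parcs G \<longleftrightarrow> u div 2 = v div 2 \<and> u \<noteq> v" if uv: "u < 2 * p" "v < 2 * p" for u v
  proof (cases "u div 2 = v div 2")
    case True
    have "u div 2 < p" using uv by auto
    moreover have "u = v \<longleftrightarrow> (even u \<longleftrightarrow> even v)" using True by presburger
    moreover have "(x, x) \<notin> parcs G" for x using pair_no_loops[of "(x, x)"] by auto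
    ultimately show ?thesis using True ab ba by (auto simp: h_def)
  next
    case False
    have "u div 2 < p" "v div 2 < p" using uv by auto
    then have "anticomplete (\<lambda>u v. (u, v) \<in> parcs G) {a (u div 2), b (u div 2)} {a (v div 2), b (v div 2)}"
      using anti False by blast
    then show ?thesis using False by (auto simp: h_def anticomplete_def)
  qed
  have "inj_on h {..<2 * p}"
  proof (rule inj_onI)
    fix u v assume uv: "u \<in> {..<2 * p}" "v \<in> {..<2 * p}" "h u = h v"
    \<comment> \<open>\<open>u'\<close> is the partner of \<open>u\<close> in its edge. If
      \<open>h u = h v\<close>, then \<open>h v\<close> is adjacent to \<open>h u'\<close>, so
      \<open>v\<close> belongs to the same edge as \<open>u\<close>.\<close>
    define u' where "u' = (if even u then u + 1 else u - 1)"
    have u': "u' < 2 * p" "u' div 2 = u div 2" "u' \<noteq> u"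
      using uv(1) by (auto simp: u'_def; presburger)+
    then have "(h v, h u') \<in> parcs G" using adj[of u u'] uv by simp
    then have "v div 2 = u div 2" using adj[of v u'] uv u' by simp
    then show "u = v" using adj[of u v] uv pair_no_loops[of "(h v, h v)"] by auto
  qed
  moreover have "h ` {..<2 * p} \<subseteq> pverts G" using ab by (auto simp: h_def less_mult_imp_div_less mult.commute)
  ultimately show ?thesis
    using adj pK2_arc_iff[of _ p] by (intro exI[of _ h]) (auto simp: pK2_def)
qed

lemma embedding_if_not_wheel_free:
  assumes "pair_graph G" "\<not> wheel_free (\<lambda>u v. (u, v) \<in> parcs G) (pverts G)"
  shows "\<exists>h. inj_on h (pverts K1_join_C4) \<and> h ` pverts K1_join_C4 \<subseteq> pverts G \<and>
    (\<forall>u\<in>pverts K1_join_C4. \<forall>v\<in>pverts K1_join_C4. (h u, h v) \<in> parcs G \<longleftrightarrow> (u, v) \<in> parcs K1_join_C4)"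
proof -
  interpret pair_graph G by fact
  obtain a b c d t where S: "a \<in> pverts G" "b \<in> pverts G" "c \<in> pverts G" "d \<in> pverts G" "t \<in> pverts G"
    and ne: "a \<noteq> c" "b \<noteq> d"
    and arcs: "(a, b) \<in> parcs G" "(b, c) \<in> parcs G" "(c, d) \<in> parcs G" "(d, a) \<in> parcs G"
      "(t, a) \<in> parcs G" "(t, b) \<in> parcs G" "(t, c) \<in> parcs G" "(t, d) \<in> parcs G"
    and non: "(a, c) \<notin> parcs G" "(b, d) \<notin> parcs G"
    using assms(2) unfolding wheel_free_def by blast
  have comm: "(x, y) \<in> parcs G \<longleftrightarrow> (y, x) \<in> parcs G" for x y using arcs_symmetric by auto
  have loop: "(x, x) \<notin> parcs G" for x using pair_no_loops[of "(x, x)"] by auto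
  have rev_arcs: "(b, a) \<in> parcs G" "(c, b) \<in> parcs G" "(d, c) \<in> parcs G" "(a, d) \<in> parcs G"
      "(a, t) \<in> parcs G" "(b, t) \<in> parcs G" "(c, t) \<in> parcs G" "(d, t) \<in> parcs G"
      "(c, a) \<notin> parcs G" "(d, b) \<notin> parcs G"
    using arcs non comm by blast+
  have dist: "distinct [a, b, c, d, t]" using arcs ne loop by auto
  define h where "h = (!) [a, b, c, d, t]"
  have h: "h 0 = a" "h 1 = b" "h 2 = c" "h 3 = d" "h 4 = t" "h (Suc 0) = b" by (auto simp: h_def)
  have "inj_on h {0, 1, 2, 3, 4}" using dist by (auto simp: inj_on_def h)
  then show ?thesis
    using S arcs non rev_arcs loop by (intro exI[of _ h]) (auto simp: K1_join_C4_def Let_def h)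
qed

theorem theorem3p11:
  fixes p :: nat and G :: "'a pair_pre_digraph"
  assumes "p \<ge> 2"
    and "pair_graph G"
    and "induced_free {pK2 p, K1_join_C4} G"
  shows "chromatic_number G \<le> f_bound p (clique_number G)"
proof -
  interpret pair_graph G by fact
  let ?E = "\<lambda>u v. (u, v) \<in> parcs G"
  interpret graph ?E
    by unfold_locales (use arcs_symmetric pair_no_loops in force)+
  interpret matching: pair_graph "pK2 p" by (rule pair_graph_pK2)
  interpret wheel: pair_graph K1_join_C4 by (rule pair_graph_K1_join_C4)
  have wf: "pair_wf_digraph G" by unfold_locales
  have wf_F: "pair_wf_digraph (pK2 p)" "pair_wf_digraph K1_join_C4" by unfold_locales
  have no_copy: "\<not> (\<exists>H. induced_subgraph H (with_proj G) \<and> digraph_iso (with_proj F) H)"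
    if "F \<in> {pK2 p, K1_join_C4}" for F
    using assms(3) that unfolding induced_free_def by metis
  have "\<not> induced_matching ?E (pverts G) p"
    using no_copy[of "pK2 p", unfolded induced_copy_iff_embedding[OF wf_F(1) wf]]
      embedding_if_induced_matching[OF assms(2), of p] by (meson insertI1)
  moreover have "wheel_free ?E (pverts G)"
    using no_copy[of K1_join_C4, unfolded induced_copy_iff_embedding[OF wf_F(2) wf]]
      embedding_if_not_wheel_free[OF assms(2)] by (meson insertI1 insertI2)
  moreover have "card C \<le> clique_number G" if "C \<subseteq> pverts G" "clique ?E C" for C
  proof -
    have "{C. is_clique G C} \<subseteq> Pow (pverts G)" by (auto simp: is_clique_def)
    then have "finite {C. is_clique G C}" by (rule finite_subset) simp
    moreover have "is_clique G C" using that by (simp add: is_clique_def clique_def)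
    ultimately show ?thesis unfolding clique_number_def by (intro Max_ge) auto
  qed
  ultimately have "colorable ?E (pverts G) (f_bound p (clique_number G))"
    using colorable_f_bound[OF assms(1) pair_finite_verts] by blast
  then obtain c :: "'a \<Rightarrow> nat" where c: "\<forall>v\<in>pverts G. c v < f_bound p (clique_number G)"
    "\<forall>u\<in>pverts G. \<forall>v\<in>pverts G. (u, v) \<in> parcs G \<longrightarrow> c u \<noteq> c v"
    unfolding colorable_def by blast
  then have "proper_coloring G (f_bound p (clique_number G)) c"
    unfolding proper_coloring_def by (auto dest: in_arcsD1 in_arcsD2)
  then have "\<exists>c. proper_coloring G (f_bound p (clique_number G)) c" by blast
  then show ?thesis unfolding chromatic_number_def by (rule Least_le)
qed

end
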